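(* Let $k$ be a positive integer and let $G$ be a connected, triangle-free graph of order $n$ with minimum degree $\delta$. Then $$SW_k(G) \leq \frac{k-1}{k+1}\,\frac{2(n+1)}{\delta}\binom{n}{k} + \Big(\frac{4\delta-2}{\delta}+3k+1\Big)\binom{n}{k},$$ and thus (for $k\le n$, so that $\mu_k(G)$ is defined) $$\mu_k(G) \leq \frac{k-1}{k+1}\,\frac{2(n+1)}{\delta} + \frac{4\delta-2}{\delta}+3k+1.$$
   Context: All graphs are finite and simple; the order of a graph is its number of vertices. For a non-empty set $S$ of vertices of a connected graph $G$, the Steiner distance $d_G(S)$ is the minimum size (number of edges) of a connected subgraph of $G$ containing all vertices of $S$. For a positive integer $k$, the Steiner $k$-Wiener index of a connected graph $G$ is $SW_k(G)=\sum_{S\subseteq V(G),\,|S|=k} d_G(S)$. For $G$ of order $n\ge k$, the average Steiner $k$-distance is $\mu_k(G)=\binom{n}{k}^{-1}SW_k(G)$. *)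

theory Defs
  imports Complex_Main
begin

text \<open>A graph is given by its vertex set \<open>V\<close> and its edge set \<open>E\<close>, a set of two-element subsets
  of \<open>V\<close>; vertices \<open>x\<close> and \<open>y\<close> are adjacent iff \<open>{x, y} \<in> E\<close>.\<close>

definition simple_graph :: "'a set \<Rightarrow> 'a set set \<Rightarrow> bool" where
  "simple_graph V E \<longleftrightarrow> finite V \<and> (\<forall>e\<in>E. e \<subseteq> V \<and> card e = 2)"

text \<open>The null graph is not connected.\<close>

definition connected_graph :: "'a set \<Rightarrow> 'a set set \<Rightarrow> bool" where
  "connected_graph V E \<longleftrightarrow>
     simple_graph V E \<and> V \<noteq> {} \<and> (\<forall>u\<in>V. \<forall>v\<in>V. (u, v) \<in> {(x, y). {x, y} \<in> E}\<^sup>*)"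

definition subgraph_of :: "'a set \<Rightarrow> 'a set set \<Rightarrow> 'a set \<Rightarrow> 'a set set \<Rightarrow> bool" where
  "subgraph_of W F V E \<longleftrightarrow> simple_graph W F \<and> W \<subseteq> V \<and> F \<subseteq> E"

text \<open>Edges have two elements, so \<open>x\<close>, \<open>y\<close>, \<open>z\<close> are automatically distinct here.\<close>

definition triangle_free :: "'a set set \<Rightarrow> bool" where
  "triangle_free E \<longleftrightarrow> \<not> (\<exists>x y z. {x, y} \<in> E \<and> {y, z} \<in> E \<and> {x, z} \<in> E)"

definition degree :: "'a set set \<Rightarrow> 'a \<Rightarrow> nat" where
  "degree E v = card {e \<in> E. v \<in> e}"

definition min_degree :: "'a set \<Rightarrow> 'a set set \<Rightarrow> nat" where
  "min_degree V E = Min (degree E ` V)"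

text \<open>For a connected graph and \<open>S \<subseteq> V\<close> the minimum is over a nonempty set of sizes, since the
  whole graph is a candidate.\<close>

definition steiner_distance :: "'a set \<Rightarrow> 'a set set \<Rightarrow> 'a set \<Rightarrow> nat" where
  "steiner_distance V E S =
     (LEAST m. \<exists>W F. subgraph_of W F V E \<and> connected_graph W F \<and> S \<subseteq> W \<and> card F = m)"

definition steiner_wiener :: "nat \<Rightarrow> 'a set \<Rightarrow> 'a set set \<Rightarrow> nat" where
  "steiner_wiener k V E = (\<Sum>S \<in> {S. S \<subseteq> V \<and> card S = k}. steiner_distance V E S)"

definition average_steiner_distance :: "nat \<Rightarrow> 'a set \<Rightarrow> 'a set set \<Rightarrow> real" where
  "average_steiner_distance k V E =
     inverse (real (card V choose k)) * real (steiner_wiener k V E)"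

end

theory Submission
  imports Defs
begin

text \<open>Two adjacent vertices of a triangle-free graph have no common neighbour, so the union of their
  neighbourhoods, \<open>edge_nbhd E e\<close> for an edge \<open>e\<close>, contains at least \<open>2 * \<delta>\<close> vertices. Grow a
  family \<open>M\<close> of edges with pairwise disjoint neighbourhoods, always adding an edge at distance
  three from the family, for as long as possible (\<open>edge_packing_exists\<close>). At the end every vertex
  reaches an edge of \<open>M\<close> along a path with at most three vertices before that edge
  (\<open>vertex_near_packing\<close>), and \<open>M\<close> is connected by paths of length three. Assign every vertex to
  such an edge, and the vertices of \<open>edge_nbhd E e\<close> to \<open>e\<close> itself. This gives clusters of at least
  \<open>2 * \<delta>\<close> vertices each.

  For a \<open>k\<close>-set \<open>S\<close>, let \<open>T\<close> be a connected subfamily of \<open>M\<close> that contains the clusters of \<open>S\<close>.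
  The edges in \<open>T\<close> together with \<open>card T - 1\<close> connecting paths have at most \<open>4 * card T - 2\<close>
  vertices, and joining the members of \<open>S\<close> costs at most \<open>3 * k\<close> more; hence the Steiner distance of
  \<open>S\<close> is at most \<open>4 * (card T - 1) + 3 * k + 1\<close> (\<open>steiner_distance_le_hull\<close>).

  It remains to bound the average of \<open>card T - 1\<close> in a connected graph whose vertices have weight
  at least \<open>N = 2 * \<delta>\<close> and total weight \<open>n\<close> (\<open>connected_hulls_sum_bound\<close>). Repeatedly remove the
  lightest vertex that is not a cut vertex, and give its weight to a neighbour. A vertex of weight \<open>a\<close>
  contributes to \<open>T\<close> only for those sets \<open>S\<close> that have members both inside and outside its cluster;
  there are \<open>split_count n k a\<close> of them, a number that increases with \<open>a\<close> up to \<open>n / 2\<close>. Some other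
  vertex that is not a cut vertex is at least as heavy, so while \<open>i + 2\<close> vertices remain,
  \<open>2 * a + i * N \<le> n\<close>: no worse than for a path of vertices of weight \<open>N\<close>. The bounds
  \<open>(n - i * N) / 2\<close> on \<open>a\<close> are \<open>N / 2\<close> apart, so the sum of their split counts is at most \<open>1 / N\<close>
  times the sum of \<open>split_count n k a\<close> over all \<open>a \<le> n\<close>, up to an error from the largest term
  (\<open>spaced_split_count_bound\<close>). The full sum is
  \<open>(k - 1) / (k + 1) * (n + 1) * (n choose k)\<close> by the hockey-stick identity.\<close>

section \<open>Connected sets of vertices\<close>

text \<open>Connectedness is expressed by cuts: every proper non-empty part of \<open>U\<close> is left by some step of
  \<open>R\<close>. For symmetric \<open>R\<close> and finite \<open>U\<close> this is the usual notion, and it makes unions and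
  one-point extensions easy to handle. It serves both the graph itself and the graph of clusters.\<close>

definition connected_in :: "('b \<Rightarrow> 'b \<Rightarrow> bool) \<Rightarrow> 'b set \<Rightarrow> bool" where
  "connected_in R U \<longleftrightarrow>
     U \<noteq> {} \<and> (\<forall>A. A \<noteq> {} \<and> A \<subset> U \<longrightarrow> (\<exists>a\<in>A. \<exists>b\<in>U - A. R a b))"

lemma connected_in_nonempty: "connected_in R U \<Longrightarrow> U \<noteq> {}"
  by (simp add: connected_in_def)

lemma connected_in_cut:
  assumes "connected_in R U" "A \<noteq> {}" "A \<subset> U"
  obtains a b where "a \<in> A" "b \<in> U - A" "R a b"
  using assms unfolding connected_in_def by blast

lemma connected_in_singleton: "connected_in R {a}"
  unfolding connected_in_def by auto

lemma connected_in_Un: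
  assumes "symp R" "connected_in R A" "connected_in R B" "A \<inter> B \<noteq> {}"
  shows "connected_in R (A \<union> B)"
  unfolding connected_in_def
proof (intro conjI allI impI)
  show "A \<union> B \<noteq> {}"
    using assms(4) by auto
next
  fix C
  assume C: "C \<noteq> {} \<and> C \<subset> A \<union> B"
  have cross: "\<exists>a\<in>C. \<exists>b\<in>A \<union> B - C. R a b"
    if conn: "connected_in R D" and DAB: "D \<subseteq> A \<union> B" and "D \<inter> C \<noteq> {}" and "\<not> D \<subseteq> C" for D
  proof -
    have "D \<inter> C \<subset> D"
      using that by auto
    then obtain a b where "a \<in> D \<inter> C" "b \<in> D - D \<inter> C" "R a b"
      using connected_in_cut[OF conn \<open>D \<inter> C \<noteq> {}\<close>] by metis
    then show ?thesis
      using DAB by blast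
  qed
  have "(A \<inter> C \<noteq> {} \<and> \<not> A \<subseteq> C) \<or> (B \<inter> C \<noteq> {} \<and> \<not> B \<subseteq> C)"
    using C assms(4) by blast
  then show "\<exists>a\<in>C. \<exists>b\<in>A \<union> B - C. R a b"
    using cross[OF assms(2)] cross[OF assms(3)] by auto
qed

lemma connected_in_pair: "symp R \<Longrightarrow> R a b \<Longrightarrow> connected_in R {a, b}"
  unfolding connected_in_def by (auto dest: sympD)

lemma connected_in_insert:
  assumes "symp R" "connected_in R U" "a \<in> U" "R a b"
  shows "connected_in R (insert b U)"
proof -
  have "connected_in R (U \<union> {a, b})"
    using assms by (intro connected_in_Un connected_in_pair) auto
  then show ?thesis
    using assms(3) by (simp add: insert_absorb Un_insert_right insert_commute)
qed

lemma connected_in_Un_UN: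
  assumes "symp R" "finite I" "connected_in R W"
    and "\<And>i. i \<in> I \<Longrightarrow> connected_in R (Z i)" "\<And>i. i \<in> I \<Longrightarrow> W \<inter> Z i \<noteq> {}"
  shows "connected_in R (W \<union> (\<Union>i\<in>I. Z i))"
  using assms(2,4,5)
proof (induction I rule: finite_induct)
  case empty
  then show ?case using assms(3) by simp
next
  case (insert i I)
  have "connected_in R ((W \<union> (\<Union>i\<in>I. Z i)) \<union> Z i)"
  proof (rule connected_in_Un[OF assms(1)])
    show "connected_in R (W \<union> (\<Union>i\<in>I. Z i))" "connected_in R (Z i)"
      using insert by auto
    show "(W \<union> (\<Union>i\<in>I. Z i)) \<inter> Z i \<noteq> {}"
      using insert.prems(2)[of i] by auto
  qed
  then show ?case
    by (simp add: Un_commute Un_left_commute Un_assoc)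
qed

text \<open>A largest connected proper subset through \<open>r\<close> can be extended by one more vertex, and the result
  is connected and so must be all of \<open>U\<close>. The added vertex is the one that can be removed. Using
  this for two choices of \<open>r\<close> gives two removable vertices.\<close>

lemma connected_in_removable:
  assumes "symp R" "finite U" "connected_in R U" "r \<in> U" "U \<noteq> {r}"
  obtains v where "v \<in> U" "v \<noteq> r" "connected_in R (U - {v})"
proof -
  define C where "C = {A. A \<subset> U \<and> r \<in> A \<and> connected_in R A}"
  have "finite C"
    by (rule finite_subset[of _ "Pow U"]) (use assms(2) in \<open>auto simp: C_def\<close>)
  moreover have "C \<noteq> {}"
  proof -
    have "{r} \<subset> U"
      using assms(4,5) by auto
    then have "{r} \<in> C"
      by (simp add: C_def connected_in_singleton)
    then show ?thesis by auto
  qed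
  ultimately have "\<exists>A\<in>C. \<forall>B\<in>C. A \<subseteq> B \<longrightarrow> A = B"
    by (rule finite_has_maximal)
  then obtain A where A: "A \<in> C" and max: "\<And>B. B \<in> C \<Longrightarrow> A \<subseteq> B \<Longrightarrow> A = B"
    by blast
  from A obtain a b where ab: "a \<in> A" "b \<in> U - A" "R a b"
    using connected_in_cut[OF assms(3), of A] unfolding C_def by blast
  have "connected_in R (insert b A)"
    using connected_in_insert[OF assms(1) _ ab(1,3)] A unfolding C_def by auto
  then have "insert b A = U"
    using max[of "insert b A"] A ab unfolding C_def by blast
  then have "A = U - {b}"
    using ab by auto
  then show thesis
    using that[of b] A ab unfolding C_def by auto
qed

text \<open>Every finite connected set is obtained from one point by adding neighbours one at a time; this
  replaces induction along a spanning tree.\<close>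

lemma connected_in_induct [consumes 3, case_names singleton insert]:
  assumes "symp R" "finite U" "connected_in R U"
    and singleton: "\<And>r. P {r}"
    and insert: "\<And>U a b. finite U \<Longrightarrow> connected_in R U \<Longrightarrow> P U \<Longrightarrow> a \<in> U \<Longrightarrow> b \<notin> U \<Longrightarrow> R a b
                   \<Longrightarrow> P (insert b U)"
  shows "P U"
  using assms(2,3)
proof (induction "card U" arbitrary: U rule: less_induct)
  case less
  obtain r where r: "r \<in> U"
    using less.prems connected_in_nonempty by blast
  show ?case
  proof (cases "U = {r}")
    case True
    then show ?thesis using singleton by simp
  next
    case False
    obtain v where v: "v \<in> U" "v \<noteq> r" "connected_in R (U - {v})"
      using connected_in_removable[OF assms(1) less.prems r False] .
    obtain a b where ab: "a \<in> {v}" "b \<in> U - {v}" "R a b"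
      using v r less.prems by (elim connected_in_cut[of R U "{v}"]) auto
    have "P (U - {v})"
      using less.hyps less.prems v by (metis card_Diff1_less finite_Diff)
    then have "P (insert v (U - {v}))"
      using insert[of "U - {v}" b v] less.prems v ab sympD[OF assms(1)] by auto
    then show ?thesis
      using v by (simp add: insert_absorb)
  qed
qed

section \<open>Counting subsets split by a two-part partition\<close>

text \<open>For an \<open>n\<close>-set and a part of size \<open>a\<close>, this is the number of \<open>k\<close>-subsets that meet both the part
  and its complement, if \<open>k \<ge> 1\<close>. It is real-valued so that the subtractions need no side
  conditions.\<close>

definition split_count :: "nat \<Rightarrow> nat \<Rightarrow> nat \<Rightarrow> real" where
  "split_count n k a = real (n choose k) - real (a choose k) - real ((n - a) choose k)"

lemma card_split_subsets:
  assumes "finite X" "L \<subseteq> X" "1 \<le> k"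
  shows "real (card {S. S \<subseteq> X \<and> card S = k \<and> \<not> S \<subseteq> L \<and> \<not> S \<subseteq> X - L}) =
    split_count (card X) k (card L)"
proof -
  let ?M = "{S. S \<subseteq> X \<and> card S = k \<and> \<not> S \<subseteq> L \<and> \<not> S \<subseteq> X - L}"
  let ?A = "{S. S \<subseteq> L \<and> card S = k}"
  let ?B = "{S. S \<subseteq> X - L \<and> card S = k}"
  have fin: "finite L"
    using assms finite_subset by blast
  have eq: "{S. S \<subseteq> X \<and> card S = k} = ?M \<union> (?A \<union> ?B)"
    using assms(2) by auto
  have finM: "finite ?M" "finite ?A" "finite ?B"
    by (rule finite_subset[of _ "Pow X"]; use assms(1,2) in auto)+
  have "False" if "S \<in> ?A" "S \<in> ?B" for S
  proof -
    have "S = {}"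
      using that by auto
    then show False
      using that(1) assms(3) by simp
  qed
  then have "?A \<inter> ?B = {}"
    by (meson disjoint_iff)
  moreover have "?M \<inter> (?A \<union> ?B) = {}"
    by auto
  ultimately have "card {S. S \<subseteq> X \<and> card S = k} = card ?M + (card ?A + card ?B)"
    unfolding eq using finM by (simp add: card_Un_disjoint)
  then have "card X choose k = card ?M + ((card L choose k) + ((card X - card L) choose k))"
    using n_subsets[OF assms(1)] n_subsets[OF fin] n_subsets[of "X - L" k] assms(1,2) fin
    by (simp add: card_Diff_subset)
  then show ?thesis
    unfolding split_count_def by linarith
qed

lemma split_count_mono:
  assumes "a \<le> b" "2 * b \<le> n" "1 \<le> k"
  shows "split_count n k a \<le> split_count n k b"
  using assms(1,2)
proof (induction b rule: dec_induct)
  case base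
  then show ?case by simp
next
  case (step b)
  obtain j where k: "k = Suc j"
    using assms(3) by (cases k) auto
  define d where "d = n - Suc b"
  have d: "n - b = Suc d" "n - Suc b = d" "b \<le> d"
    using step.prems unfolding d_def by auto
  have "b choose j \<le> d choose j"
    using d(3) by (rule binomial_right_mono)
  then have "split_count n k b \<le> split_count n k (Suc b)"
    unfolding split_count_def k d by simp
  moreover have "split_count n k a \<le> split_count n k b"
    using step.IH step.prems by simp
  ultimately show ?case
    by linarith
qed

lemma split_count_le: "split_count n k a \<le> real (n choose k)"
  unfolding split_count_def by simp

text \<open>Two applications of the hockey-stick identity. This is where the factor
  \<open>(k - 1) / (k + 1) = 1 - 2 / (k + 1)\<close> comes from.\<close>

lemma sum_split_count:
  "(\<Sum>a\<le>n. split_count n k a) = (real k - 1) / (real k + 1) * (real n + 1) * real (n choose k)"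
proof -
  have up: "(\<Sum>a\<le>n. real (a choose k)) = real (Suc n choose Suc k)"
    using sum_choose_upper[of k n] by (simp flip: of_nat_sum add: atMost_atLeast0)
  have down: "(\<Sum>a\<le>n. real ((n - a) choose k)) = (\<Sum>a\<le>n. real (a choose k))"
    by (rule sum.reindex_bij_witness[of _ "\<lambda>a. n - a" "\<lambda>a. n - a"]) auto
  have "real (Suc k) * real (Suc n choose Suc k) = real (Suc n) * real (n choose k)"
    using Suc_times_binomial_eq[of n k] by (metis mult.commute of_nat_mult)
  then have "real (Suc n choose Suc k) = (real n + 1) * real (n choose k) / (real k + 1)"
    by (simp add: field_simps)
  then show ?thesis
    unfolding split_count_def sum_subtractf up down
    by (simp add: field_simps)
qed

text \<open>As \<open>y\<close> runs through \<open>0, \<dots>, n\<close>, the halves \<open>y div 2\<close> list the values of the symmetric function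
  \<open>split_count n k\<close> in increasing order: even \<open>y\<close> stand for the arguments up to \<open>n / 2\<close>, and odd
  \<open>y\<close> for their mirror images above \<open>n / 2\<close>.\<close>

lemma sum_split_count_half:
  "(\<Sum>y\<le>n. split_count n k (y div 2)) = (\<Sum>a\<le>n. split_count n k a)"
proof (rule sum.reindex_bij_witness[of _
      "\<lambda>a. if 2 * a \<le> n then 2 * a else 2 * (n - a) + 1"
      "\<lambda>y. if even y then y div 2 else n - y div 2"])
  fix y
  assume "y \<in> {..n}"
  then show "split_count n k (if even y then y div 2 else n - y div 2) = split_count n k (y div 2)"
    by (auto simp: split_count_def)
qed (auto elim!: evenE oddE)

text \<open>A sample of a monotone function at distance \<open>N\<close> is charged to the \<open>N\<close> values from its position
  upwards. Only the sample at \<open>n\<close> has no room above, which costs \<open>N - 1\<close> extra copies of \<open>g n\<close>.\<close>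

lemma spaced_sum_bound:
  fixes g :: "nat \<Rightarrow> real"
  assumes mono: "\<And>x y. x \<le> y \<Longrightarrow> y \<le> n \<Longrightarrow> g x \<le> g y" and "j * N \<le> n" and "1 \<le> N"
  shows "real N * (\<Sum>i\<le>j. g (n - i * N)) \<le> (real N - 1) * g n + (\<Sum>y\<in>{n - j * N..n}. g y)"
  using assms(2)
proof (induction j)
  case 0
  then show ?case by (simp add: algebra_simps)
next
  case (Suc j)
  define l u where "l = n - Suc j * N" and "u = n - j * N"
  have u: "u = l + N" and "u \<le> n"
    using Suc.prems unfolding l_def u_def by (simp_all add: algebra_simps)
  have "real N * g l = (\<Sum>y\<in>{l..<u}. g l)"
    by (simp add: u)
  also have "\<dots> \<le> (\<Sum>y\<in>{l..<u}. g y)"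
    using \<open>u \<le> n\<close> by (intro sum_mono mono) auto
  finally have block: "real N * g l \<le> (\<Sum>y\<in>{l..<u}. g y)" .
  have "{l..n} = {l..<u} \<union> {u..n}"
    using u \<open>u \<le> n\<close> by auto
  then have split: "(\<Sum>y\<in>{l..n}. g y) = (\<Sum>y\<in>{l..<u}. g y) + (\<Sum>y\<in>{u..n}. g y)"
    by (simp add: sum.union_disjoint ivl_disj_int)
  have "real N * (\<Sum>i\<le>j. g (n - i * N)) \<le> (real N - 1) * g n + (\<Sum>y\<in>{u..n}. g y)"
    using Suc unfolding u_def by simp
  moreover have "(\<Sum>i\<le>Suc j. g (n - i * N)) = (\<Sum>i\<le>j. g (n - i * N)) + g l"
    by (simp add: l_def)
  ultimately have "real N * (\<Sum>i\<le>Suc j. g (n - i * N)) \<le>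
      (real N - 1) * g n + (\<Sum>y\<in>{l..n}. g y)"
    unfolding split using block by (simp add: distrib_left)
  then show ?case
    unfolding l_def .
qed

text \<open>The sum on the left bounds the cost of reducing a connected graph on \<open>m\<close> clusters to one cluster,
  last removal first: when \<open>i + 2\<close> clusters are left, each with at least \<open>N\<close> of the \<open>n\<close> points, the
  one removed has at most \<open>(n - i * N) div 2\<close> points.\<close>

lemma spaced_split_count_bound:
  assumes "m * N \<le> n" "1 \<le> N" "1 \<le> k"
  shows "real N * (\<Sum>i<m - 1. split_count n k ((n - i * N) div 2)) \<le>
    ((real k - 1) / (real k + 1) * (real n + 1) + (real N - 1)) * real (n choose k)"
proof (cases "m \<le> 1")
  case True
  then have "m - 1 = 0" by simp
  then show ?thesis
    using assms by simp
next
  case False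
  then obtain j where m: "m = Suc (Suc j)"
    by (metis One_nat_def Suc_le_D not_less_eq_eq)
  let ?g = "\<lambda>y. split_count n k (y div 2)"
  have mono: "?g x \<le> ?g y" if "x \<le> y" "y \<le> n" for x y
    using that assms(3) by (intro split_count_mono) auto
  have nonneg: "0 \<le> ?g y" if "y \<le> n" for y
    using mono[of 0 y] that assms(3) by (simp add: split_count_def binomial_eq_0)
  have "real N * (\<Sum>i\<le>j. ?g (n - i * N)) \<le> (real N - 1) * ?g n + (\<Sum>y\<in>{n - j * N..n}. ?g y)"
    using assms m by (intro spaced_sum_bound mono) auto
  also have "\<dots> \<le> (real N - 1) * real (n choose k) + (\<Sum>y\<le>n. ?g y)"
    using assms(2) nonneg by (intro add_mono mult_left_mono split_count_le sum_mono2) auto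
  finally show ?thesis
    unfolding sum_split_count_half sum_split_count
    by (simp add: m lessThan_Suc_atMost algebra_simps)
qed

section \<open>Average size of connected hulls in a weighted graph\<close>

text \<open>The set \<open>T S\<close> plays the role of a Steiner tree for the clusters that \<open>S\<close> meets. The induction
  removes the lightest removable vertex \<open>l\<close> and moves its cluster to a neighbour \<open>p\<close>. A set \<open>S\<close>
  with members in the cluster of \<open>l\<close> and outside it then has \<open>p\<close> in its smaller hull, so \<open>l\<close> can be
  attached at the cost of one vertex; a set inside the cluster of \<open>l\<close> needs \<open>l\<close> alone, and all
  other sets keep their hull.\<close>

lemma connected_hulls_sum_bound:
  assumes "symp R" "finite X" "1 \<le> k"
    and "finite U" "connected_in R U" "c ` X \<subseteq> U"
    and "\<And>u. u \<in> U \<Longrightarrow> N \<le> card {x \<in> X. c x = u}"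
  shows "\<exists>T. (\<forall>S. S \<subseteq> X \<and> card S = k \<longrightarrow> connected_in R (T S) \<and> T S \<subseteq> U \<and> c ` S \<subseteq> T S) \<and>
    (\<Sum>S\<in>{S. S \<subseteq> X \<and> card S = k}. real (card (T S)) - 1) \<le>
      (\<Sum>i<card U - 1. split_count (card X) k ((card X - i * N) div 2))"
  using assms(4-7)
proof (induction "card U" arbitrary: U c rule: less_induct)
  case less
  define w where "w u = card {x \<in> X. c x = u}" for u
  let ?K = "{S. S \<subseteq> X \<and> card S = k}"
  have finK: "finite ?K"
    by (rule finite_subset[of _ "Pow X"]) (use assms(2) in auto)
  obtain r where r: "r \<in> U"
    using less.prems connected_in_nonempty by blast
  show ?case
  proof (cases "U = {r}")
    case True
    then show ?thesis
      using less.prems by (intro exI[of _ "\<lambda>_. {r}"]) (auto simp: connected_in_singleton)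
  next
    case False
    define M where "M = {v \<in> U. connected_in R (U - {v})}"
    have other: "\<exists>v'\<in>M. v' \<noteq> v" if "v \<in> U" for v
    proof -
      have "U \<noteq> {v}"
        using False r by auto
      then show ?thesis
        using connected_in_removable[OF assms(1) less.prems(1,2) that] unfolding M_def by blast
    qed
    have "M \<noteq> {}" "finite M"
      using other[OF r] less.prems unfolding M_def by auto
    then obtain l where l: "l \<in> M" and lmin: "\<And>v. v \<in> M \<Longrightarrow> w l \<le> w v"
      using arg_min_if_finite[of M w] by (metis not_less)
    have lU: "l \<in> U" and connl: "connected_in R (U - {l})"
      using l unfolding M_def by auto
    obtain l' where l': "l' \<in> M" "l' \<noteq> l"
      using other[OF lU] by auto
    have l'U: "l' \<in> U"
      using l' unfolding M_def by auto
    obtain l1 p where lp: "l1 \<in> {l}" "p \<in> U - {l}" "R l1 p"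
      using less.prems lU l' l'U by (elim connected_in_cut[of R U "{l}"]) auto
    have Rpl: "R p l"
      using lp sympD[OF assms(1)] by auto
    have cardU: "card U = Suc (Suc (card U - 2))"
    proof -
      have "card {l, l'} \<le> card U"
        using less.prems lU l'U by (intro card_mono) auto
      then show ?thesis
        using l' by auto
    qed
    have total: "card X = (\<Sum>u\<in>U. w u)"
    proof -
      show ?thesis
        using sum.group[OF assms(2) less.prems(1,3), of "\<lambda>_. 1::nat"] unfolding w_def by simp
    qed
    have "(\<Sum>u\<in>U. w u) = w l + w l' + (\<Sum>u\<in>U - {l, l'}. w u)"
    proof -
      have "U = {l, l'} \<union> (U - {l, l'})"
        using lU l'U by auto
      then have "(\<Sum>u\<in>U. w u) = (\<Sum>u\<in>{l, l'}. w u) + (\<Sum>u\<in>U - {l, l'}. w u)"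
        using less.prems(1) by (metis Diff_disjoint finite.emptyI finite.insertI finite_Diff sum.union_disjoint)
      then show ?thesis
        using l' by simp
    qed
    moreover have "card (U - {l, l'}) * N \<le> (\<Sum>u\<in>U - {l, l'}. w u)"
      using less.prems(4) unfolding w_def by (intro sum_bounded_below[where 'a=nat, simplified]) auto
    moreover have "card (U - {l, l'}) = card U - 2"
      using lU l'U l' less.prems(1) by (simp add: card_Diff_subset)
    \<comment> \<open>The second removable vertex \<open>l'\<close> is at least as heavy as \<open>l\<close>, so \<open>l\<close> has at most half of
      the weight that the other \<open>card U - 2\<close> vertices leave.\<close>
    ultimately have "2 * w l + (card U - 2) * N \<le> card X"
      using lmin[OF l'(1)] total by simp
    then have wl: "w l \<le> (card X - (card U - 2) * N) div 2"
      by linarith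
    define c' where "c' x = (if c x = l then p else c x)" for x
    have "\<exists>T. (\<forall>S. S \<subseteq> X \<and> card S = k \<longrightarrow>
              connected_in R (T S) \<and> T S \<subseteq> U - {l} \<and> c' ` S \<subseteq> T S) \<and>
            (\<Sum>S\<in>?K. real (card (T S)) - 1) \<le>
              (\<Sum>i<card (U - {l}) - 1. split_count (card X) k ((card X - i * N) div 2))"
    proof (rule less.hyps)
      show "card (U - {l}) < card U"
        using lU less.prems(1) by (meson card_Diff1_less)
      show "finite (U - {l})" "connected_in R (U - {l})"
        using less.prems connl by auto
      show "c' ` X \<subseteq> U - {l}"
        using less.prems(3) lp unfolding c'_def by auto
      show "N \<le> card {x \<in> X. c' x = u}" if "u \<in> U - {l}" for u
      proof -
        have "card {x \<in> X. c x = u} \<le> card {x \<in> X. c' x = u}"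
          using that assms(2) by (intro card_mono) (auto simp: c'_def)
        then show ?thesis
          using less.prems(4)[of u] that by auto
      qed
    qed
    then obtain T' where T'conn: "\<forall>S. S \<subseteq> X \<and> card S = k \<longrightarrow>
          connected_in R (T' S) \<and> T' S \<subseteq> U - {l} \<and> c' ` S \<subseteq> T' S"
      and T'sum: "(\<Sum>S\<in>?K. real (card (T' S)) - 1) \<le>
              (\<Sum>i<card (U - {l}) - 1. split_count (card X) k ((card X - i * N) div 2))"
      by blast
    have T': "\<And>S. S \<in> ?K \<Longrightarrow> connected_in R (T' S)"
        "\<And>S. S \<in> ?K \<Longrightarrow> T' S \<subseteq> U - {l}" "\<And>S. S \<in> ?K \<Longrightarrow> c' ` S \<subseteq> T' S"
      using T'conn by simp_all
    define L where "L = {x \<in> X. c x = l}"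
    define T where "T S = (if S \<subseteq> L then {l} else if S \<subseteq> X - L then T' S else insert l (T' S))" for S
    have T: "connected_in R (T S) \<and> T S \<subseteq> U \<and> c ` S \<subseteq> T S" if S: "S \<in> ?K" for S
    proof -
      consider "S \<subseteq> L" | "\<not> S \<subseteq> L" "S \<subseteq> X - L" | "\<not> S \<subseteq> L" "\<not> S \<subseteq> X - L"
        by blast
      then show ?thesis
      proof cases
        case 1
        then show ?thesis
          using lU by (auto simp: T_def L_def connected_in_singleton)
      next
        case 2
        have "c' ` S = c ` S"
          using 2 by (auto simp: c'_def L_def intro!: image_cong)
        then show ?thesis
          using 2 T'[OF S] by (auto simp: T_def)
      next
        case 3
        then obtain x where "x \<in> S" "c x = l"
          using S by (auto simp: L_def)
        then have "p \<in> T' S"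
          using T'(3)[OF S] by (auto simp: c'_def)
        then have "connected_in R (insert l (T' S))"
          using connected_in_insert[OF assms(1) T'(1)[OF S] _ Rpl] by simp
        moreover have "c ` S \<subseteq> insert l (T' S)"
          using T'(3)[OF S] by (auto simp: c'_def split: if_splits)
        ultimately show ?thesis
          using 3 T'(2)[OF S] lU by (auto simp: T_def)
      qed
    qed
    let ?split = "{S. S \<subseteq> X \<and> card S = k \<and> \<not> S \<subseteq> L \<and> \<not> S \<subseteq> X - L}"
    have Tcard: "real (card (T S)) - 1 \<le> (real (card (T' S)) - 1) + (if S \<in> ?split then 1 else 0)"
      if S: "S \<in> ?K" for S
    proof -
      have "finite (T' S)"
        using T'(2)[OF S] less.prems(1) by (meson finite_Diff finite_subset)
      moreover have "T' S \<noteq> {}"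
        using T'(1)[OF S] connected_in_nonempty by blast
      ultimately have "1 \<le> card (T' S)" "card (insert l (T' S)) \<le> card (T' S) + 1"
        by (auto simp: Suc_le_eq card_gt_0_iff card_insert_if)
      then show ?thesis
        using S by (auto simp: T_def)
    qed
    have "(\<Sum>S\<in>?K. if S \<in> ?split then 1 else 0 :: real) = (\<Sum>S\<in>?split. 1)"
      by (rule sum.mono_neutral_cong_right) (use finK in auto)
    also have "\<dots> = split_count (card X) k (w l)"
      using card_split_subsets[OF assms(2) _ assms(3), of L] by (simp add: L_def w_def)
    finally have ind: "(\<Sum>S\<in>?K. if S \<in> ?split then 1 else 0 :: real) = split_count (card X) k (w l)" .
    have "(\<Sum>S\<in>?K. real (card (T S)) - 1) \<le>
        (\<Sum>S\<in>?K. (real (card (T' S)) - 1) + (if S \<in> ?split then 1 else 0))"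
      using Tcard by (intro sum_mono) auto
    also have "\<dots> = (\<Sum>S\<in>?K. real (card (T' S)) - 1) + split_count (card X) k (w l)"
      using ind by (simp only: sum.distrib)
    also have "\<dots> \<le> (\<Sum>i<card U - 2. split_count (card X) k ((card X - i * N) div 2))
        + split_count (card X) k ((card X - (card U - 2) * N) div 2)"
    proof (rule add_mono)
      have "card (U - {l}) - 1 = card U - 2"
        using lU less.prems(1) by simp
      then show "(\<Sum>S\<in>?K. real (card (T' S)) - 1) \<le>
          (\<Sum>i<card U - 2. split_count (card X) k ((card X - i * N) div 2))"
        using T'sum by simp
      show "split_count (card X) k (w l) \<le>
          split_count (card X) k ((card X - (card U - 2) * N) div 2)"
        using wl assms(3) by (intro split_count_mono) auto
    qed
    also have "\<dots> = (\<Sum>i<card U - 1. split_count (card X) k ((card X - i * N) div 2))"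
    proof -
      have "card U - 1 = Suc (card U - 2)"
        using cardU by simp
      then show ?thesis by simp
    qed
    finally show ?thesis
      using T by (intro exI[of _ T]) auto
  qed
qed

section \<open>Steiner distance and connected vertex sets\<close>

definition adj :: "'a set set \<Rightarrow> 'a \<Rightarrow> 'a \<Rightarrow> bool" where
  "adj E x y \<longleftrightarrow> {x, y} \<in> E"

lemma symp_adj: "symp (adj E)"
  by (auto simp: symp_def adj_def insert_commute)

lemma simple_graph_finite:
  assumes "simple_graph V E"
  shows "finite V" "finite E"
proof -
  show "finite V"
    using assms by (simp add: simple_graph_def)
  moreover have "E \<subseteq> Pow V"
    using assms by (auto simp: simple_graph_def)
  ultimately show "finite E"
    by (meson finite_Pow_iff finite_subset)
qed

lemma connected_graphD:
  assumes "connected_graph V E"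
  shows "simple_graph V E" "V \<noteq> {}"
  using assms by (simp_all add: connected_graph_def)

lemma connected_graph_connected_in:
  assumes "connected_graph V E"
  shows "connected_in (adj E) V"
  unfolding connected_in_def
proof (intro conjI allI impI)
  show "V \<noteq> {}"
    using assms unfolding connected_graph_def by auto
  fix A
  assume A: "A \<noteq> {} \<and> A \<subset> V"
  then obtain u v where uv: "u \<in> A" "v \<in> V" "v \<notin> A"
    by blast
  then have "(u, v) \<in> {(x, y). {x, y} \<in> E}\<^sup>*"
    using A assms unfolding connected_graph_def by auto
  then have "v \<in> A \<or> (\<exists>a\<in>A. \<exists>b\<in>V - A. adj E a b)"
  proof (induction rule: rtrancl_induct)
    case base
    then show ?case using uv by auto
  next
    case (step y z)
    have "z \<in> V"
      using step assms unfolding connected_graph_def simple_graph_def by auto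
    then show ?case
      using step by (auto simp: adj_def)
  qed
  then show "\<exists>a\<in>A. \<exists>b\<in>V - A. adj E a b"
    using uv by auto
qed

text \<open>A spanning tree grows together with the vertex set. Hence upper bounds on Steiner distances only
  need connected vertex sets and their sizes.\<close>

lemma connected_in_spanning_tree:
  assumes "simple_graph V E" "W \<subseteq> V" "connected_in (adj E) W"
  shows "\<exists>F. connected_graph W F \<and> F \<subseteq> E \<and> card F + 1 = card W"
proof -
  have fin: "finite W"
    using assms finite_subset unfolding simple_graph_def by blast
  show ?thesis
    using symp_adj fin assms(3)
  proof (induction rule: connected_in_induct)
    case (singleton r)
    then show ?case
      by (intro exI[of _ "{}"]) (auto simp: connected_graph_def simple_graph_def)
  next
    case (insert U a b)
    then obtain F where F: "connected_graph U F" "F \<subseteq> E" "card F + 1 = card U"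
      by auto
    let ?F = "insert {a, b} F"
    have ab: "a \<noteq> b" "{a, b} \<in> E"
      using insert by (auto simp: adj_def)
    have finF: "finite F"
      using simple_graph_finite(2)[OF connected_graphD(1)[OF F(1)]] .
    have new: "{a, b} \<notin> F"
      using F(1) insert unfolding connected_graph_def simple_graph_def by auto
    let ?r = "{(x, y). {x, y} \<in> ?F}\<^sup>*"
    have toa: "(u, a) \<in> ?r \<and> (a, u) \<in> ?r" if "u \<in> insert b U" for u
    proof (cases "u = b")
      case True
      then show ?thesis
        by (auto simp: insert_commute)
    next
      case False
      then have "(u, a) \<in> {(x, y). {x, y} \<in> F}\<^sup>*" "(a, u) \<in> {(x, y). {x, y} \<in> F}\<^sup>*"
        using that F(1) insert unfolding connected_graph_def by auto
      moreover have "{(x, y). {x, y} \<in> F}\<^sup>* \<subseteq> ?r"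
        by (intro rtrancl_mono) auto
      ultimately show ?thesis by auto
    qed
    have "connected_graph (insert b U) ?F"
      unfolding connected_graph_def
    proof (intro conjI ballI)
      show "simple_graph (insert b U) ?F"
        using F(1) insert ab unfolding connected_graph_def simple_graph_def by auto
      show "(u, v) \<in> ?r" if "u \<in> insert b U" "v \<in> insert b U" for u v
        using toa that by (meson rtrancl_trans)
    qed auto
    moreover have "card ?F + 1 = card (insert b U)"
      using F(3) new finF insert by simp
    ultimately show ?case
      using F(2) ab by blast
  qed
qed

lemma steiner_distance_less_card:
  assumes "simple_graph V E" "W \<subseteq> V" "connected_in (adj E) W" "S \<subseteq> W"
  shows "steiner_distance V E S + 1 \<le> card W"
proof -
  obtain F where F: "connected_graph W F" "F \<subseteq> E" "card F + 1 = card W"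
    using connected_in_spanning_tree[OF assms(1-3)] by auto
  have "steiner_distance V E S \<le> card F"
    unfolding steiner_distance_def
    using F assms by (intro Least_le) (auto simp: subgraph_of_def connected_graph_def)
  then show ?thesis
    using F(3) by simp
qed

section \<open>Clusters around edges of a triangle-free graph\<close>

text \<open>For an edge \<open>e\<close> this contains \<open>e\<close> itself, since each end is a neighbour of the other.\<close>

definition edge_nbhd :: "'a set set \<Rightarrow> 'a set \<Rightarrow> 'a set" where
  "edge_nbhd E e = {v. \<exists>x\<in>e. adj E x v}"

text \<open>For edges with disjoint neighbourhoods, the set \<open>P\<close> holds the two inner vertices of a path of
  length three from \<open>e\<close> to \<open>f\<close>.\<close>

definition linked :: "'a set \<Rightarrow> 'a set set \<Rightarrow> 'a set \<Rightarrow> 'a set \<Rightarrow> bool" where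
  "linked V E e f \<longleftrightarrow> (\<exists>P. P \<subseteq> V \<and> card P \<le> 2 \<and> connected_in (adj E) (e \<union> P \<union> f))"

lemma symp_linked: "symp (linked V E)"
  by (auto simp: symp_def linked_def Un_commute Un_left_commute Un_assoc)

lemma simple_graph_edgeE:
  assumes "simple_graph V E" "e \<in> E"
  obtains x y where "e = {x, y}" "x \<noteq> y" "adj E x y" "x \<in> V" "y \<in> V"
proof -
  have "card e = 2" "e \<subseteq> V"
    using assms unfolding simple_graph_def by auto
  then show thesis
    using that assms(2) by (auto simp: card_2_iff adj_def)
qed

lemma adj_in_V: "simple_graph V E \<Longrightarrow> adj E x y \<Longrightarrow> x \<in> V \<and> y \<in> V"
  unfolding simple_graph_def adj_def by auto

lemma connected_in_edge: "simple_graph V E \<Longrightarrow> e \<in> E \<Longrightarrow> connected_in (adj E) e"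
  by (erule (1) simple_graph_edgeE) (simp add: connected_in_pair symp_adj)

lemma connected_graph_has_nbr:
  assumes "connected_graph V E" "E \<noteq> {}" "v \<in> V"
  obtains w where "adj E v w"
proof -
  note sg = connected_graphD(1)[OF assms(1)]
  obtain e where "e \<in> E"
    using assms(2) by blast
  then obtain x y where "x \<in> V" "y \<in> V" "x \<noteq> y"
    by (rule simple_graph_edgeE[OF sg])
  then have "{v} \<subset> V"
    using assms(3) by auto
  then obtain w where "adj E v w"
    using connected_in_cut[OF connected_graph_connected_in[OF assms(1)], of "{v}"] by blast
  then show thesis
    by (rule that)
qed

lemma degree_eq_card_nbrs:
  assumes "simple_graph V E"
  shows "degree E v = card {w. adj E v w}"
proof -
  have "bij_betw (\<lambda>w. {v, w}) {w. adj E v w} {e \<in> E. v \<in> e}"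
    unfolding bij_betw_def
  proof
    show "inj_on (\<lambda>w. {v, w}) {w. adj E v w}"
      by (auto simp: inj_on_def doubleton_eq_iff)
    show "(\<lambda>w. {v, w}) ` {w. adj E v w} = {e \<in> E. v \<in> e}"
    proof (intro equalityI subsetI)
      fix e
      assume "e \<in> {e \<in> E. v \<in> e}"
      then show "e \<in> (\<lambda>w. {v, w}) ` {w. adj E v w}"
        using assms by (auto elim!: simple_graph_edgeE simp: adj_def insert_commute)
    qed (auto simp: adj_def)
  qed
  then show ?thesis
    unfolding degree_def by (metis bij_betw_same_card)
qed

lemma card_edge_nbhd:
  assumes "simple_graph V E" "triangle_free E" "e \<in> E"
  shows "2 * min_degree V E \<le> card (edge_nbhd E e)"
proof -
  obtain x y where xy: "e = {x, y}" "adj E x y" "x \<in> V" "y \<in> V"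
    using assms by (metis simple_graph_edgeE)
  note finV = simple_graph_finite(1)[OF assms(1)]
  have nbr: "min_degree V E \<le> card {w. adj E v w}" "finite {w. adj E v w}" if "v \<in> V" for v
  proof -
    show "min_degree V E \<le> card {w. adj E v w}"
      unfolding min_degree_def degree_eq_card_nbrs[OF assms(1), symmetric]
      using that finV by auto
    show "finite {w. adj E v w}"
      using adj_in_V[OF assms(1)] finV by (metis (mono_tags, lifting) finite_subset mem_Collect_eq subsetI)
  qed
  have "{w. adj E x w} \<inter> {w. adj E y w} = {}"
    using assms(2) xy(2) unfolding triangle_free_def adj_def by blast
  moreover have "edge_nbhd E e = {w. adj E x w} \<union> {w. adj E y w}"
    unfolding edge_nbhd_def xy by auto
  ultimately show ?thesis
    using nbr[OF xy(3)] nbr[OF xy(4)] by (simp add: card_Un_disjoint)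
qed

lemma edge_subset_nbhd: "simple_graph V E \<Longrightarrow> e \<in> E \<Longrightarrow> e \<subseteq> edge_nbhd E e"
  by (erule (1) simple_graph_edgeE) (auto simp: edge_nbhd_def adj_def insert_commute)

lemma connected_in_insert_nbhd:
  assumes "connected_in (adj E) W" "e \<subseteq> W" "v \<in> edge_nbhd E e"
  shows "connected_in (adj E) (insert v W)"
proof -
  obtain x where "x \<in> e" "adj E x v"
    using assms(3) unfolding edge_nbhd_def by blast
  then show ?thesis
    using assms(2) by (intro connected_in_insert[OF symp_adj assms(1)]) auto
qed

text \<open>Take a largest connected packing \<open>M\<close>, and suppose that some edge is far from it, that is, its
  neighbourhood avoids those of all edges in \<open>M\<close>. Since the graph is connected, some vertex \<open>a\<close> on no
  far edge is adjacent to an end \<open>b\<close> of a far edge \<open>e'\<close>. The edge \<open>{a, b}\<close> is not far, so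
  \<open>a\<close> or \<open>b\<close> has a neighbour \<open>p\<close> in the neighbourhood of some \<open>f \<in> M\<close>. As \<open>e'\<close> is far, it is \<open>a\<close>,
  and then \<open>a\<close> and \<open>p\<close> link \<open>e'\<close> to \<open>f\<close>: the packing can be enlarged.\<close>

lemma edge_packing_exists:
  assumes "connected_graph V E" "E \<noteq> {}"
  obtains M where "M \<subseteq> E" "connected_in (linked V E) M"
    "\<And>e f. e \<in> M \<Longrightarrow> f \<in> M \<Longrightarrow> e \<noteq> f \<Longrightarrow> edge_nbhd E e \<inter> edge_nbhd E f = {}"
    "\<And>e. e \<in> E \<Longrightarrow> \<exists>f\<in>M. edge_nbhd E e \<inter> edge_nbhd E f \<noteq> {}"
proof -
  note sg = connected_graphD(1)[OF assms(1)]
  note finE = simple_graph_finite(2)[OF sg]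
  let ?packing = "\<lambda>M. M \<subseteq> E \<and> connected_in (linked V E) M \<and>
    (\<forall>e\<in>M. \<forall>f\<in>M. e \<noteq> f \<longrightarrow> edge_nbhd E e \<inter> edge_nbhd E f = {})"
  define C where "C = {M. ?packing M}"
  have "finite C"
    by (rule finite_subset[of _ "Pow E"]) (use finE in \<open>auto simp: C_def\<close>)
  moreover have "C \<noteq> {}"
  proof -
    obtain e where "e \<in> E"
      using assms(2) by auto
    then have "{e} \<in> C"
      by (simp add: C_def connected_in_singleton)
    then show ?thesis by auto
  qed
  ultimately have "\<exists>M\<in>C. \<forall>M'\<in>C. M \<subseteq> M' \<longrightarrow> M = M'"
    by (rule finite_has_maximal)
  then obtain M where "M \<in> C" and maxC: "\<And>M'. M' \<in> C \<Longrightarrow> M \<subseteq> M' \<Longrightarrow> M = M'"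
    by blast
  then have M: "?packing M"
    unfolding C_def by simp
  have max: "M = M'" if "?packing M'" "M \<subseteq> M'" for M'
    using maxC[of M'] that unfolding C_def by simp
  define far where "far e \<longleftrightarrow> e \<in> E \<and> (\<forall>f\<in>M. edge_nbhd E e \<inter> edge_nbhd E f = {})" for e
  have "\<not> far e" for e
  proof
    assume "far e"
    define A where "A = {v \<in> V. \<not> (\<exists>e. far e \<and> v \<in> e)}"
    have "A \<noteq> {}"
    proof -
      have "M \<noteq> {}"
        using M connected_in_nonempty[of "linked V E" M] by simp
      then obtain f where f: "f \<in> M" "f \<in> E"
        using M by blast
      obtain x y where xy: "f = {x, y}" "adj E x y" "x \<in> V"
        using simple_graph_edgeE[OF sg f(2)] by metis
      \<comment> \<open>An edge through an end \<open>x\<close> of a member of \<open>M\<close> shares the other end as a neighbour.\<close>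
      have "\<not> far e'" if "x \<in> e'" for e'
      proof -
        have "y \<in> edge_nbhd E e' \<inter> edge_nbhd E f"
          using that xy by (auto simp: edge_nbhd_def)
        then show ?thesis
          using f unfolding far_def by blast
      qed
      then have "x \<in> A"
        using xy unfolding A_def by auto
      then show ?thesis by auto
    qed
    moreover have "A \<subset> V"
    proof -
      obtain x where "x \<in> e" "x \<in> V"
        using \<open>far e\<close> simple_graph_edgeE[OF sg, of e] unfolding far_def by blast
      then show ?thesis
        using \<open>far e\<close> unfolding A_def by auto
    qed
    ultimately obtain a b where ab: "a \<in> A" "b \<in> V - A" "adj E a b"
      using connected_in_cut[OF connected_graph_connected_in[OF assms(1)]] by metis
    obtain e' where e': "far e'" "b \<in> e'"
      using ab unfolding A_def by auto
    have "{a, b} \<in> E" "\<not> far {a, b}"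
      using ab unfolding A_def adj_def by auto
    then obtain f p where f: "f \<in> M" and p: "p \<in> edge_nbhd E {a, b}" "p \<in> edge_nbhd E f"
      unfolding far_def by auto
    have "\<not> adj E b p"
      using e' p(2) f unfolding far_def edge_nbhd_def by blast
    then have ap: "adj E a p"
      using p(1) by (auto simp: edge_nbhd_def)
    have fE: "f \<in> E" and e'E: "e' \<in> E"
      using f M e' unfolding far_def by auto
    have "connected_in (adj E) (insert p f)"
      using connected_in_insert_nbhd[OF connected_in_edge[OF sg fE] _ p(2)] by auto
    then have "connected_in (adj E) (insert a (insert p f))"
      using connected_in_insert[OF symp_adj _ _ sympD[OF symp_adj ap]] by auto
    moreover have "connected_in (adj E) (insert a e')"
      using connected_in_insert[OF symp_adj connected_in_edge[OF sg e'E] e'(2)]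
        sympD[OF symp_adj ab(3)] by auto
    ultimately have "connected_in (adj E) (insert a (insert p f) \<union> insert a e')"
      by (intro connected_in_Un symp_adj) auto
    moreover have "insert a (insert p f) \<union> insert a e' = f \<union> {a, p} \<union> e'"
      by auto
    moreover have "{a, p} \<subseteq> V"
      using adj_in_V[OF sg ap] by auto
    moreover have "card {a, p} \<le> 2"
      by (simp add: card_insert_if)
    ultimately have "linked V E f e'"
      unfolding linked_def by (intro exI[of _ "{a, p}"]) auto
    then have "connected_in (linked V E) (insert e' M)"
      using M by (intro connected_in_insert[OF symp_linked _ f]) simp_all
    moreover have "edge_nbhd E e' \<inter> edge_nbhd E g = {}" "edge_nbhd E g \<inter> edge_nbhd E e' = {}"
      if "g \<in> M" for g
      using e'(1) that unfolding far_def by (auto simp: Int_commute)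
    ultimately have "?packing (insert e' M)"
      using M e'E by simp
    then have "e' \<in> M"
      using max[of "insert e' M"] by auto
    then have "edge_nbhd E e' = {}"
      using e' unfolding far_def by blast
    then show False
      using edge_subset_nbhd[OF sg e'E] e'(2) by auto
  qed
  then have "\<exists>f\<in>M. edge_nbhd E e \<inter> edge_nbhd E f \<noteq> {}" if "e \<in> E" for e
    using that unfolding far_def by simp
  then show thesis
    using that[of M] M by simp
qed

text \<open>The first edge needs two vertices; every further edge brings its own two vertices and at most two
  on the path that links it to an earlier one.\<close>

lemma linked_edges_connector:
  assumes "simple_graph V E" "T \<subseteq> E" "connected_in (linked V E) T"
  shows "\<exists>W\<subseteq>V. connected_in (adj E) W \<and> \<Union>T \<subseteq> W \<and> card W + 2 \<le> 4 * card T"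
proof -
  have fin: "finite T"
    using assms(2) simple_graph_finite(2)[OF assms(1)] finite_subset by blast
  have "T \<subseteq> E \<longrightarrow> ?thesis"
    using symp_linked fin assms(3)
  proof (induction rule: connected_in_induct)
    case (singleton e)
    show ?case
    proof
      assume "{e} \<subseteq> E"
      then have "connected_in (adj E) e" "e \<subseteq> V" "card e = 2"
        using connected_in_edge[OF assms(1)] assms(1) unfolding simple_graph_def by auto
      then show "\<exists>W\<subseteq>V. connected_in (adj E) W \<and> \<Union>{e} \<subseteq> W \<and> card W + 2 \<le> 4 * card {e}"
        by (intro exI[of _ e]) auto
    qed
  next
    case (insert U e f)
    show ?case
    proof
      assume UE: "insert f U \<subseteq> E"
      then obtain W where W: "W \<subseteq> V" "connected_in (adj E) W" "\<Union>U \<subseteq> W" "card W + 2 \<le> 4 * card U"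
        using insert by auto
      obtain P where P: "P \<subseteq> V" "card P \<le> 2" "connected_in (adj E) (e \<union> P \<union> f)"
        using insert unfolding linked_def by auto
      have e: "e \<noteq> {}" "e \<subseteq> W"
        using insert UE W(3) connected_in_nonempty[OF connected_in_edge[OF assms(1)]] by auto
      have f: "f \<subseteq> V" "card f = 2"
        using UE assms(1) unfolding simple_graph_def by auto
      have "connected_in (adj E) (W \<union> (e \<union> P \<union> f))"
        using e by (intro connected_in_Un[OF symp_adj W(2) P(3)]) auto
      moreover have "W \<union> (e \<union> P \<union> f) = W \<union> P \<union> f"
        using e by auto
      moreover have "card (W \<union> P \<union> f) \<le> card W + card P + card f"
        by (meson card_Un_le add_le_mono le_refl order_trans)
      ultimately show "\<exists>W\<subseteq>V. connected_in (adj E) W \<and> \<Union>(insert f U) \<subseteq> W \<and>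
          card W + 2 \<le> 4 * card (insert f U)"
        using W P f insert by (intro exI[of _ "W \<union> P \<union> f"]) auto
    qed
  qed
  then show ?thesis
    using assms(2) by blast
qed

text \<open>Any edge \<open>{v, w}\<close> at \<open>v\<close> has a neighbour \<open>q\<close> in common with some edge of the packing, and
  \<open>{v, w, q}\<close> can serve as \<open>Q\<close> whether \<open>q\<close> is adjacent to \<open>v\<close> or to \<open>w\<close>.\<close>

lemma vertex_near_packing:
  assumes "connected_graph V E" "E \<noteq> {}" "v \<in> V" "M \<subseteq> E"
    and "\<And>e. e \<in> E \<Longrightarrow> \<exists>f\<in>M. edge_nbhd E e \<inter> edge_nbhd E f \<noteq> {}"
  shows "\<exists>f\<in>M. \<exists>Q\<subseteq>V. v \<in> Q \<and> card Q \<le> 3 \<and> connected_in (adj E) (Q \<union> f)"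
proof -
  note sg = connected_graphD(1)[OF assms(1)]
  obtain w where w: "adj E v w"
    using connected_graph_has_nbr[OF assms(1-3)] .
  then obtain f q where f: "f \<in> M" and q: "q \<in> edge_nbhd E {v, w}" "q \<in> edge_nbhd E f"
    using assms(5)[of "{v, w}"] by (auto simp: adj_def)
  have "f \<in> E"
    using f assms(4) by auto
  then have qf: "connected_in (adj E) (insert q f)"
    using connected_in_insert_nbhd[OF connected_in_edge[OF sg] _ q(2)] by auto
  obtain z where z: "z \<in> {v, w}" "adj E z q"
    using q(1) unfolding edge_nbhd_def by blast
  then have "adj E q z"
    using sympD[OF symp_adj] by metis
  then have "connected_in (adj E) (insert z (insert q f))"
    using connected_in_insert[OF symp_adj qf] by blast
  moreover have "connected_in (adj E) {v, w}"
    using w by (intro connected_in_pair symp_adj)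
  ultimately have "connected_in (adj E) ({v, w} \<union> insert z (insert q f))"
    using z(1) connected_in_Un[OF symp_adj] by blast
  moreover have "{v, w} \<union> insert z (insert q f) = {v, w, q} \<union> f"
    using z by auto
  moreover have "{v, w, q} \<subseteq> V"
    using adj_in_V[OF sg w] adj_in_V[OF sg z(2)] by auto
  moreover have "card {v, w, q} \<le> 3"
    by (simp add: card_insert_if)
  ultimately show ?thesis
    using f by (intro bexI[of _ f] exI[of _ "{v, w, q}"]) auto
qed

section \<open>The bound on the Steiner Wiener index\<close>

lemma steiner_distance_le_hull:
  assumes "simple_graph V E" "S \<subseteq> V" "T \<subseteq> E" "connected_in (linked V E) T" "c ` S \<subseteq> T"
    and Q: "\<And>v. v \<in> S \<Longrightarrow> Q v \<subseteq> V \<and> v \<in> Q v \<and> card (Q v) \<le> 3 \<and> connected_in (adj E) (Q v \<union> c v)"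
  shows "steiner_distance V E S + 3 \<le> 4 * card T + 3 * card S"
proof -
  obtain W where W: "W \<subseteq> V" "connected_in (adj E) W" "\<Union>T \<subseteq> W" "card W + 2 \<le> 4 * card T"
    using linked_edges_connector[OF assms(1,3,4)] by auto
  have finS: "finite S"
    using assms(1,2) finite_subset unfolding simple_graph_def by blast
  have c: "c v \<subseteq> W" "c v \<noteq> {}" if "v \<in> S" for v
  proof -
    have cv: "c v \<in> T"
      using that assms(5) by auto
    then show "c v \<subseteq> W"
      using W(3) by auto
    show "c v \<noteq> {}"
      using cv assms(3) connected_in_nonempty[OF connected_in_edge[OF assms(1)]] by auto
  qed
  let ?W = "W \<union> (\<Union>v\<in>S. Q v)"
  have "connected_in (adj E) (W \<union> (\<Union>v\<in>S. Q v \<union> c v))"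
  proof (rule connected_in_Un_UN[OF symp_adj finS W(2)])
    fix v
    assume v: "v \<in> S"
    show "connected_in (adj E) (Q v \<union> c v)"
      using Q[OF v] by simp
    show "W \<inter> (Q v \<union> c v) \<noteq> {}"
      using c[OF v] by auto
  qed
  moreover have "W \<union> (\<Union>v\<in>S. Q v \<union> c v) = ?W"
    using c by auto
  ultimately have "steiner_distance V E S + 1 \<le> card ?W"
    using W(1) Q by (intro steiner_distance_less_card[OF assms(1)]) auto
  also have "card ?W \<le> card W + card (\<Union>v\<in>S. Q v)"
    by (rule card_Un_le)
  also have "card (\<Union>v\<in>S. Q v) \<le> (\<Sum>v\<in>S. card (Q v))"
    by (rule card_UN_le[OF finS])
  also have "\<dots> \<le> card S * 3"
    using Q sum_bounded_above[of S "\<lambda>v. card (Q v)" 3] by auto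
  finally show ?thesis
    using W(4) by linarith
qed

lemma min_degree_pos:
  assumes "connected_graph V E" "E \<noteq> {}"
  shows "1 \<le> min_degree V E"
proof -
  note sg = connected_graphD(1)[OF assms(1)]
  have "finite V" "V \<noteq> {}"
    using simple_graph_finite(1)[OF sg] connected_graphD(2)[OF assms(1)] by simp_all
  have "degree E v \<noteq> 0" if "v \<in> V" for v
  proof -
    obtain w where w: "adj E v w"
      using connected_graph_has_nbr[OF assms \<open>v \<in> V\<close>] .
    have "{w. adj E v w} \<subseteq> V"
      using adj_in_V[OF sg] by auto
    then have "finite {w. adj E v w}"
      using \<open>finite V\<close> finite_subset by blast
    then show ?thesis
      using w by (auto simp: degree_eq_card_nbrs[OF sg])
  qed
  then show ?thesis
    unfolding min_degree_def using \<open>finite V\<close> \<open>V \<noteq> {}\<close> by (simp add: Suc_le_eq)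
qed

lemma steiner_wiener_bound:
  assumes "1 \<le> k" "connected_graph V E" "triangle_free E" "E \<noteq> {}"
  defines "n \<equiv> card V" and "\<delta> \<equiv> min_degree V E"
  shows "real (steiner_wiener k V E) \<le>
    ((real k - 1) / (real k + 1) * (2 * (real n + 1) / real \<delta>)
      + (4 * real \<delta> - 2) / real \<delta> + 3 * real k + 1) * real (n choose k)"
proof -
  note sg = connected_graphD(1)[OF assms(2)]
  note finV = simple_graph_finite(1)[OF sg]
  let ?K = "{S. S \<subseteq> V \<and> card S = k}"
  obtain M where M: "M \<subseteq> E" "connected_in (linked V E) M"
    and disj: "\<And>e f. e \<in> M \<Longrightarrow> f \<in> M \<Longrightarrow> e \<noteq> f \<Longrightarrow> edge_nbhd E e \<inter> edge_nbhd E f = {}"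
    and cover: "\<And>e. e \<in> E \<Longrightarrow> \<exists>f\<in>M. edge_nbhd E e \<inter> edge_nbhd E f \<noteq> {}"
    using edge_packing_exists[OF assms(2,4)] by metis
  have finM: "finite M"
    using M(1) simple_graph_finite(2)[OF sg] finite_subset by blast
  have nV: "edge_nbhd E e \<subseteq> V" for e
    using adj_in_V[OF sg] by (auto simp: edge_nbhd_def)
  \<comment> \<open>A vertex in the neighbourhood of a packing edge must be assigned to that very edge, to make the
    clusters large.\<close>
  have near: "\<exists>f Q. f \<in> M \<and> (\<forall>e\<in>M. v \<in> edge_nbhd E e \<longrightarrow> f = e) \<and>
      Q \<subseteq> V \<and> v \<in> Q \<and> card Q \<le> 3 \<and> connected_in (adj E) (Q \<union> f)" if v: "v \<in> V" for v
  proof (cases "\<exists>e\<in>M. v \<in> edge_nbhd E e")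
    case True
    then obtain e where e: "e \<in> M" "v \<in> edge_nbhd E e"
      by auto
    have "connected_in (adj E) (insert v e)"
      using connected_in_insert_nbhd[OF connected_in_edge[OF sg] _ e(2)] e M(1) by auto
    then show ?thesis
      using e v disj by (intro exI[of _ e] exI[of _ "{v}"]) auto
  next
    case False
    then show ?thesis
      using vertex_near_packing[OF assms(2,4) v M(1) cover] by blast
  qed
  then obtain c Q where c: "\<And>v. v \<in> V \<Longrightarrow> c v \<in> M"
    and cn: "\<And>v e. v \<in> V \<Longrightarrow> e \<in> M \<Longrightarrow> v \<in> edge_nbhd E e \<Longrightarrow> c v = e"
    and Q: "\<And>v. v \<in> V \<Longrightarrow> Q v \<subseteq> V \<and> v \<in> Q v \<and> card (Q v) \<le> 3 \<and> connected_in (adj E) (Q v \<union> c v)"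
    by metis
  have weight: "2 * \<delta> \<le> card {x \<in> V. c x = u}" if u: "u \<in> M" for u
  proof -
    have "2 * \<delta> \<le> card (edge_nbhd E u)"
      unfolding \<delta>_def using card_edge_nbhd[OF sg assms(3)] u M(1) by auto
    also have "\<dots> \<le> card {x \<in> V. c x = u}"
      using nV cn u finV by (intro card_mono) auto
    finally show ?thesis .
  qed
  have "c ` V \<subseteq> M"
    using c by auto
  from connected_hulls_sum_bound[OF symp_linked finV assms(1) finM M(2) this weight]
  obtain T where Tall: "\<forall>S. S \<subseteq> V \<and> card S = k \<longrightarrow>
      connected_in (linked V E) (T S) \<and> T S \<subseteq> M \<and> c ` S \<subseteq> T S"
    and Tsum: "(\<Sum>S\<in>?K. real (card (T S)) - 1) \<le>
      (\<Sum>i<card M - 1. split_count n k ((n - i * (2 * \<delta>)) div 2))"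
    unfolding n_def by blast
  have T: "connected_in (linked V E) (T S) \<and> T S \<subseteq> M \<and> c ` S \<subseteq> T S" if "S \<in> ?K" for S
    using Tall that by simp
  have packed: "card M * (2 * \<delta>) \<le> n"
  proof -
    have "card M * (2 * \<delta>) \<le> (\<Sum>u\<in>M. card {x \<in> V. c x = u})"
      using sum_mono[OF weight, of M] by simp
    also have "\<dots> = n"
      using sum.group[OF finV finM, of c "\<lambda>_. 1::nat"] c unfolding n_def by auto
    finally show ?thesis .
  qed
  have \<delta>: "1 \<le> \<delta>"
    unfolding \<delta>_def using assms min_degree_pos by blast
  have cardK: "card ?K = n choose k"
    unfolding n_def by (rule n_subsets[OF finV])
  let ?B = "((real k - 1) / (real k + 1) * (real n + 1) + (2 * real \<delta> - 1)) * real (n choose k)"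
  have "2 * real \<delta> * (\<Sum>S\<in>?K. real (card (T S)) - 1) \<le>
      2 * real \<delta> * (\<Sum>i<card M - 1. split_count n k ((n - i * (2 * \<delta>)) div 2))"
    using Tsum by (intro mult_left_mono) auto
  also have "\<dots> \<le> ?B"
    using spaced_split_count_bound[OF packed _ assms(1)] \<delta> by simp
  finally have hull: "(\<Sum>S\<in>?K. real (card (T S)) - 1) \<le> ?B / (2 * real \<delta>)"
    using \<delta> by (simp add: pos_le_divide_eq mult.commute)
  have "real (steiner_wiener k V E) = (\<Sum>S\<in>?K. real (steiner_distance V E S))"
    unfolding steiner_wiener_def by simp
  also have "\<dots> \<le> (\<Sum>S\<in>?K. 4 * (real (card (T S)) - 1) + (3 * real k + 1))"
  proof (rule sum_mono)
    fix S
    assume S: "S \<in> ?K"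
    have "steiner_distance V E S + 3 \<le> 4 * card (T S) + 3 * card S"
      using S T[OF S] M(1) Q by (intro steiner_distance_le_hull[OF sg, where c = c and Q = Q]) auto
    then show "real (steiner_distance V E S) \<le> 4 * (real (card (T S)) - 1) + (3 * real k + 1)"
      using S by auto
  qed
  also have "\<dots> = 4 * (\<Sum>S\<in>?K. real (card (T S)) - 1) + real (n choose k) * (3 * real k + 1)"
    by (subst sum.distrib) (simp only: sum_distrib_left[symmetric] sum_constant cardK)
  also have "\<dots> \<le> 4 * (?B / (2 * real \<delta>)) + real (n choose k) * (3 * real k + 1)"
    by (intro add_right_mono mult_left_mono hull) simp
  also have "\<dots> = ((real k - 1) / (real k + 1) * (2 * (real n + 1) / real \<delta>)
      + (4 * real \<delta> - 2) / real \<delta> + 3 * real k + 1) * real (n choose k)"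
  proof -
    have "4 * ((r * s + (2 * d - 1)) * b / (2 * d)) + b * t = (r * (2 * s / d) + (4 * d - 2) / d + t) * b"
      if "0 < d" for r s d b t :: real
      using that by (simp add: field_simps)
    from this[of "real \<delta>" "(real k - 1) / (real k + 1)" "real n + 1" "real (n choose k)" "3 * real k + 1"]
    show ?thesis
      using \<delta> by (simp add: add.assoc)
  qed
  finally show ?thesis .
qed

text \<open>A connected graph without edges is a single vertex. Its minimum degree is zero, so there are no
  clusters and it is treated apart.\<close>

lemma steiner_wiener_edgeless:
  assumes "connected_graph V {}"
  shows "steiner_wiener k V {} = 0"
proof -
  have "steiner_distance V {} S = 0" if "S \<subseteq> V" for S
  proof -
    have "steiner_distance V {} S \<le> 0"
      unfolding steiner_distance_def
      using assms that by (intro Least_le exI[of _ V] exI[of _ "{}"])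
        (auto simp: subgraph_of_def connected_graph_def)
    then show ?thesis by simp
  qed
  then show ?thesis
    unfolding steiner_wiener_def by simp
qed

theorem corollary2:
  fixes V :: "'a set" and E :: "'a set set" and k n \<delta> :: nat
  assumes "k \<ge> 1"
    and "connected_graph V E"
    and "triangle_free E"
    and "card V = n"
    and "min_degree V E = \<delta>"
  shows "real (steiner_wiener k V E)
           \<le> (real k - 1) / (real k + 1) * (2 * (real n + 1) / real \<delta>) * real (n choose k)
             + ((4 * real \<delta> - 2) / real \<delta> + 3 * real k + 1) * real (n choose k)
         \<and> (k \<le> n \<longrightarrow> average_steiner_distance k V E
           \<le> (real k - 1) / (real k + 1) * (2 * (real n + 1) / real \<delta>)
             + (4 * real \<delta> - 2) / real \<delta> + 3 * real k + 1)"
proof -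
  let ?b = "(real k - 1) / (real k + 1) * (2 * (real n + 1) / real \<delta>)
    + (4 * real \<delta> - 2) / real \<delta> + 3 * real k + 1"
  have main: "real (steiner_wiener k V E) \<le> ?b * real (n choose k)"
  proof (cases "E = {}")
    case True
    have "V \<noteq> {}" "finite V"
      using connected_graphD[OF assms(2)] simple_graph_finite(1) by blast+
    \<comment> \<open>Division by \<open>\<delta> = 0\<close> yields zero, and what remains of the bound is non-negative.\<close>
    then have "\<delta> = 0"
      using True assms(5) by (auto simp: min_degree_def degree_def)
    then show ?thesis
      using steiner_wiener_edgeless[of V k] assms(2) True by simp
  next
    case False
    then show ?thesis
      using steiner_wiener_bound[OF assms(1-3)] assms(4,5) by simp
  qed
  have "average_steiner_distance k V E \<le> ?b" if "k \<le> n"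
  proof -
    have pos: "0 < real (n choose k)"
      using that by simp
    then have "real (steiner_wiener k V E) / real (n choose k) \<le> ?b"
      using main by (simp add: pos_divide_le_eq)
    then show ?thesis
      by (simp add: average_steiner_distance_def assms(4) divide_inverse mult.commute)
  qed
  then show ?thesis
    using main by (auto simp: algebra_simps)
qed

end
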